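(* Let $F$ be the universal formal group law, considered over $MU_*\otimes\mathbb{Q}=\mathbb{Q}[\mathbf{CP}_1,\mathbf{CP}_2,\dots]$, let $\nu(x)=x\bigl(1+\sum_{i\ge 1}\mathbf{CP}_i x^i\bigr)$, and let $\tilde F$ be the formal group law over $MU_*\otimes\mathbb{Q}$ for which $\nu$ is a strict isomorphism $F\to\tilde F$, i.e. $\nu(F(x,y))=\tilde F(\nu(x),\nu(y))$. Let $t:\mathbb{Q}[p_1,\dots,p_4]\to\mathbb{Q}[q_1,\dots,q_4]$ be the ring isomorphism defined by $t(p_i)=q_i$, and let $\kappa: MU_*\otimes\mathbb{Q}\to MU_*\otimes\mathbb{Q}$ be the classifying map of $\tilde F$. Let $\phi_{KH}: MU_*\otimes\mathbb{Q}\to\mathbb{Q}[q_1,\dots,q_4]$ be the Krichever--Höhn genus and $\psi: MU_*\otimes\mathbb{Q}\to\mathbb{Q}[p_1,\dots,p_4]$ the genus defined in the context. Then: (i) the series $\sum_{i\ge 0}\phi_{KH}(\mathbf{CP}_i)x^{i+1}$ (with $\mathbf{CP}_0=1$) is a strict isomorphism from the formal group law $\phi_{KH}(F)$ to the formal group law $t\psi(F)$ over $\mathbb{Q}[q_1,\dots,q_4]$; (ii) $\kappa$ is invertible and $\phi_{KH}=t\circ\psi\circ\kappa^{-1}$.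
   Context: All formal group laws are one-dimensional and commutative. A strict isomorphism $\nu:F\to G$ of formal group laws over $R$ is a power series $\nu(x)=x+\cdots\in R[[x]]$ with $\nu(F(x,y))=G(\nu(x),\nu(y))$. Over a $\mathbb{Q}$-algebra, the logarithm $l(x)=x+\cdots$ of $F$ is the strict isomorphism from $F$ to the additive formal group law, so $F(x,y)=l^{-1}(l(x)+l(y))$; the exponential is $l^{-1}$ (compositional inverse). The Lazard ring is identified with the complex bordism ring $MU_*$, and $MU_*\otimes\mathbb{Q}=\mathbb{Q}[\mathbf{CP}_1,\mathbf{CP}_2,\dots]$ is a polynomial ring, where $\mathbf{CP}_i$ is the bordism class of the complex projective space of complex dimension $i$ (degree $2i$). The universal formal group law $F$ over it has logarithm $\log(x)=\sum_{i\ge 0}\frac{\mathbf{CP}_i}{i+1}x^{i+1}$ with $\mathbf{CP}_0=1$. For a $\mathbb{Q}$-algebra $R$, every formal group law $G$ over $R$ is obtained from $F$ by applying a unique $\mathbb{Q}$-algebra homomorphism $r:MU_*\otimes\mathbb{Q}\to R$ to its coefficients; $r$ is the classifying map of $G$, and one writes $G=r(F)$. Thus $\kappa$ is the homomorphism carrying the logarithm $\log(x)$ of $F$ coefficientwise to the logarithm $\log(\nu^{-1}(x))$ of $\tilde F$. The genus $\psi: MU_*\otimes\mathbb{Q}\to\mathbb{Q}[p_1,p_2,p_3,p_4]$ ($p_i$ formal parameters, $|p_i|=2i$) is the $\mathbb{Q}$-algebra homomorphism such that $\psi(F)$ has logarithm $\int_0^x \frac{du}{\sqrt{1+p_1u+p_2u^2+p_3u^3+p_4u^4}}$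 (the square root having constant term $1$). The Krichever--Höhn genus $\phi_{KH}: MU_*\otimes\mathbb{Q}\to\mathbb{Q}[q_1,q_2,q_3,q_4]$ ($q_i$ formal parameters, $|q_i|=2i$) is the graded $\mathbb{Q}$-algebra homomorphism characterized by the following property: if $f(x)$ is the exponential of the formal group law $\phi_{KH}(F)$, then the Laurent series $h(x)=f'(x)/f(x)$ satisfies $(h'(x))^2=S(h(x))$, where $S(x)=x^4+q_1x^3+q_2x^2+q_3x+q_4$. *)

theory Defs
  imports
    "HOL-Library.Poly_Mapping"
    "HOL-Computational_Algebra.Formal_Laurent_Series"
begin

section \<open>Polynomial algebras over the rationals\<close>

type_synonym 'v qpoly = "('v \<Rightarrow>\<^sub>0 nat) \<Rightarrow>\<^sub>0 rat"

definition Const :: "rat \<Rightarrow> 'v qpoly" where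
  "Const c = Poly_Mapping.single 0 c"

definition Var :: "'v \<Rightarrow> 'v qpoly" where
  "Var v = Poly_Mapping.single (Poly_Mapping.single v 1) 1"

definition rat_alg_hom :: "('v qpoly \<Rightarrow> 'w qpoly) \<Rightarrow> bool" where
  "rat_alg_hom r \<longleftrightarrow>
     (\<forall>a b. r (a + b) = r a + r b) \<and>
     (\<forall>a b. r (a * b) = r a * r b) \<and>
     (\<forall>c. r (Const c) = Const c)"

definition homogeneous :: "('v \<Rightarrow> nat) \<Rightarrow> nat \<Rightarrow> 'v qpoly \<Rightarrow> bool" where
  "homogeneous w d a \<longleftrightarrow>
     (\<forall>m \<in> Poly_Mapping.keys a.
        (\<Sum>v \<in> Poly_Mapping.keys m. w v * Poly_Mapping.lookup m v) = d)"

definition graded_hom ::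
  "('v \<Rightarrow> nat) \<Rightarrow> ('w \<Rightarrow> nat) \<Rightarrow> ('v qpoly \<Rightarrow> 'w qpoly) \<Rightarrow> bool" where
  "graded_hom w w' r \<longleftrightarrow> (\<forall>d a. homogeneous w d a \<longrightarrow> homogeneous w' d (r a))"


section \<open>Power series in two and three variables\<close>

text \<open>
  A series in x, y is an iterated series whose inner variable is x: the coefficient of
  \<open>x^i y^j\<close> in \<open>F\<close> is \<open>F $ j $ i\<close>.  Likewise the coefficient of
  \<open>x^i y^j z^k\<close> in a series \<open>U\<close> in x, y, z is \<open>U $ k $ j $ i\<close>.
  In the substitutions below the substituted series are meant to have zero constant term.
  Their a-th powers then have no terms of total degree below a, so the
  finite sums compute the coefficients of the full infinite sums.
\<close>

type_synonym 'a fps2 = "'a fps fps"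
type_synonym 'a fps3 = "'a fps fps fps"

abbreviation (input) X2 :: "'a::comm_ring_1 fps2" where "X2 \<equiv> fps_const fps_X"
abbreviation (input) Y2 :: "'a::comm_ring_1 fps2" where "Y2 \<equiv> fps_X"

abbreviation (input) X3 :: "'a::comm_ring_1 fps3" where "X3 \<equiv> fps_const (fps_const fps_X)"
abbreviation (input) Y3 :: "'a::comm_ring_1 fps3" where "Y3 \<equiv> fps_const fps_X"
abbreviation (input) Z3 :: "'a::comm_ring_1 fps3" where "Z3 \<equiv> fps_X"

text \<open>The series g(u), where g has one variable and u two.\<close>

definition subst_1_2 :: "'a::comm_ring_1 fps \<Rightarrow> 'a fps2 \<Rightarrow> 'a fps2" where
  "subst_1_2 g u = Abs_fps (\<lambda>j. Abs_fps (\<lambda>i.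
     \<Sum>a\<le>i + j. g $ a * (u ^ a) $ j $ i))"

text \<open>The series F(u, v), where F, u and v have two variables.\<close>

definition subst_2_2 :: "'a::comm_ring_1 fps2 \<Rightarrow> 'a fps2 \<Rightarrow> 'a fps2 \<Rightarrow> 'a fps2" where
  "subst_2_2 F u v = Abs_fps (\<lambda>j. Abs_fps (\<lambda>i.
     \<Sum>a\<le>i + j. \<Sum>b\<le>i + j. F $ b $ a * (u ^ a * v ^ b) $ j $ i))"

text \<open>The series F(u, v), where F has two variables, u and v three.\<close>

definition subst_2_3 :: "'a::comm_ring_1 fps2 \<Rightarrow> 'a fps3 \<Rightarrow> 'a fps3 \<Rightarrow> 'a fps3" where
  "subst_2_3 F u v = Abs_fps (\<lambda>k. Abs_fps (\<lambda>j. Abs_fps (\<lambda>i.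
     \<Sum>a\<le>i + j + k. \<Sum>b\<le>i + j + k. F $ b $ a * (u ^ a * v ^ b) $ k $ j $ i)))"


section \<open>Formal group laws\<close>

text \<open>
  The first two conjuncts are \<open>F(x, 0) = x\<close> and \<open>F(0, y) = y\<close>.
\<close>

definition formal_group_law :: "'a::comm_ring_1 fps2 \<Rightarrow> bool" where
  "formal_group_law F \<longleftrightarrow>
     F $ 0 = fps_X \<and>
     Abs_fps (\<lambda>j. F $ j $ 0) = fps_X \<and>
     (\<forall>i j. F $ j $ i = F $ i $ j) \<and>
     subst_2_3 F (subst_2_3 F X3 Y3) Z3 = subst_2_3 F X3 (subst_2_3 F Y3 Z3)"

definition strict_iso :: "'a::comm_ring_1 fps2 \<Rightarrow> 'a fps2 \<Rightarrow> 'a fps \<Rightarrow> bool" where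
  "strict_iso F G \<nu> \<longleftrightarrow>
     formal_group_law F \<and> formal_group_law G \<and>
     \<nu> $ 0 = 0 \<and> \<nu> $ 1 = 1 \<and>
     subst_1_2 \<nu> F = subst_2_2 G (subst_1_2 \<nu> X2) (subst_1_2 \<nu> Y2)"

definition additive_fgl :: "'a::comm_ring_1 fps2" where
  "additive_fgl = X2 + Y2"

definition is_logarithm :: "'a::comm_ring_1 fps2 \<Rightarrow> 'a fps \<Rightarrow> bool" where
  "is_logarithm F l \<longleftrightarrow> strict_iso F additive_fgl l"

definition is_exponential :: "'a::comm_ring_1 fps2 \<Rightarrow> 'a fps \<Rightarrow> bool" where
  "is_exponential F f \<longleftrightarrow>
     (\<exists>l. is_logarithm F l \<and> f $ 0 = 0 \<and> l oo f = fps_X \<and> f oo l = fps_X)"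

text \<open>The formal group law r(F) obtained by applying r to the coefficients of F.\<close>

definition push_fgl ::
  "('a::comm_ring_1 \<Rightarrow> 'b::comm_ring_1) \<Rightarrow> 'a fps2 \<Rightarrow> 'b fps2" where
  "push_fgl r F = Abs_fps (\<lambda>j. Abs_fps (\<lambda>i. r (F $ j $ i)))"


section \<open>Rational complex bordism and the universal formal group law\<close>

text \<open>The variable with index n is the class of the projective space of dimension n + 1.\<close>

type_synonym MUQ = "nat qpoly"

fun CP :: "nat \<Rightarrow> MUQ" where
  "CP 0 = 1"
| "CP (Suc n) = Var n"

definition deg_MU :: "nat \<Rightarrow> nat" where
  "deg_MU n = 2 * (n + 1)"

definition log_MU :: "MUQ fps" where
  "log_MU = Abs_fps (\<lambda>n. case n of 0 \<Rightarrow> 0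
     | Suc i \<Rightarrow> Const (1 / of_nat (i + 1)) * CP i)"

definition is_universal_fgl :: "MUQ fps2 \<Rightarrow> bool" where
  "is_universal_fgl F \<longleftrightarrow> is_logarithm F log_MU"

definition is_classifying_map ::
  "MUQ fps2 \<Rightarrow> 'v qpoly fps2 \<Rightarrow> (MUQ \<Rightarrow> 'v qpoly) \<Rightarrow> bool" where
  "is_classifying_map F G r \<longleftrightarrow> rat_alg_hom r \<and> push_fgl r F = G"

definition nu_MU :: "MUQ fps" where
  "nu_MU = fps_X * (1 + Abs_fps (\<lambda>i. if i = 0 then 0 else CP i))"


section \<open>The two genera\<close>

datatype pvar = P1 | P2 | P3 | P4
datatype qvar = Q1 | Q2 | Q3 | Q4

fun deg_q :: "qvar \<Rightarrow> nat" where
  "deg_q Q1 = 2" | "deg_q Q2 = 4" | "deg_q Q3 = 6" | "deg_q Q4 = 8"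

definition quartic_p :: "pvar qpoly fps" where
  "quartic_p = 1 + fps_const (Var P1) * fps_X + fps_const (Var P2) * fps_X ^ 2
     + fps_const (Var P3) * fps_X ^ 3 + fps_const (Var P4) * fps_X ^ 4"

text \<open>
  The library's division and integration of power series need an inverse operation on the
  coefficient ring.  The integral of \<open>1 / s\<close> from 0 to x is therefore described as the series \<open>l\<close>
  without constant term such that \<open>l' s = 1\<close>, where \<open>s\<close> is the square root.
\<close>

definition is_elliptic_integral :: "pvar qpoly fps \<Rightarrow> bool" where
  "is_elliptic_integral l \<longleftrightarrow>
     l $ 0 = 0 \<and> (\<exists>s. s $ 0 = 1 \<and> s ^ 2 = quartic_p \<and> fps_deriv l * s = 1)"

definition is_psi :: "MUQ fps2 \<Rightarrow> (MUQ \<Rightarrow> pvar qpoly) \<Rightarrow> bool" where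
  "is_psi F \<psi> \<longleftrightarrow>
     rat_alg_hom \<psi> \<and>
     (\<exists>l. is_elliptic_integral l \<and> is_logarithm (push_fgl \<psi> F) l)"

definition S_quartic :: "qvar qpoly fls \<Rightarrow> qvar qpoly fls" where
  "S_quartic h = h ^ 4 + fls_const (Var Q1) * h ^ 3 + fls_const (Var Q2) * h ^ 2
     + fls_const (Var Q3) * h + fls_const (Var Q4)"

text \<open>
  The equation \<open>h f = f'\<close> determines the Laurent series \<open>h = f' / f\<close> uniquely, because \<open>f\<close> has
  leading coefficient 1.
\<close>

definition is_Krichever_Hoehn ::
  "MUQ fps2 \<Rightarrow> (MUQ \<Rightarrow> qvar qpoly) \<Rightarrow> bool" where
  "is_Krichever_Hoehn F \<phi> \<longleftrightarrow>
     rat_alg_hom \<phi> \<and> graded_hom deg_MU deg_q \<phi> \<and>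
     (\<exists>f h. is_exponential (push_fgl \<phi> F) f \<and>
        h * fps_to_fls f = fps_to_fls (fps_deriv f) \<and>
        (fls_deriv h) ^ 2 = S_quartic h)"

definition is_rename_iso :: "(pvar qpoly \<Rightarrow> qvar qpoly) \<Rightarrow> bool" where
  "is_rename_iso t \<longleftrightarrow>
     rat_alg_hom t \<and> bij t \<and>
     t (Var P1) = Var Q1 \<and> t (Var P2) = Var Q2 \<and>
     t (Var P3) = Var Q3 \<and> t (Var P4) = Var Q4"

end

theory Submission
  imports Defs
begin

text \<open>
  A strict isomorphism \<open>\<nu> : F \<rightarrow> G\<close> transports invariant differentials, which determines logarithms
  in characteristic 0 and gives \<open>\<kappa>(log) \<circ> \<nu> = log\<close>.  Comparing coefficients, \<open>\<kappa>\<close> sends each generator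
  to a nonzero multiple of itself plus a polynomial in the earlier ones, hence is invertible.

  Let \<open>f\<close> be the exponential of \<open>\<phi>(F)\<close> and \<open>L = \<phi>(log)\<close> its inverse.  Since \<open>\<nu> = x log'\<close>, the series
  \<open>g = \<phi>(\<nu>) \<circ> f\<close> equals \<open>f / f' = 1 / h\<close>, and the equation \<open>h'^2 = S(h)\<close> becomes
  \<open>g'^2 = 1 + q1 g + q2 g^2 + q3 g^3 + q4 g^4\<close>: thus \<open>g\<close> is the exponential of \<open>t\<psi>(F)\<close>, i.e.
  \<open>t\<psi>(log) \<circ> \<phi>(\<nu>) = L = \<phi>\<kappa>(log) \<circ> \<phi>(\<nu>)\<close>.  Hence \<open>\<phi>\<kappa> = t\<psi>\<close>, and applying \<open>\<phi>\<close> to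
  \<open>\<nu> : F \<rightarrow> \<kappa>(F)\<close> gives the isomorphism \<open>\<phi>(F) \<rightarrow> t\<psi>(F)\<close>.
\<close>

section \<open>Homomorphisms applied to coefficients\<close>

text \<open>Series in two and three variables are iterated series, so the locale is interpreted
  again for \<open>fps_map r\<close> and its iterates; \<open>hom_fps_map\<close> makes this
  possible.\<close>

locale comm_ring_1_hom =
  fixes r :: "'a::comm_ring_1 \<Rightarrow> 'b::comm_ring_1"
  assumes add: "r (a + b) = r a + r b"
    and mult: "r (a * b) = r a * r b"
    and one: "r 1 = 1"
begin

lemma zero: "r 0 = 0"
  using add[of 0 0] by simp

lemma sum: "r (\<Sum>x\<in>A. f x) = (\<Sum>x\<in>A. r (f x))"
  by (induction A rule: infinite_finite_induct) (simp_all add: zero add)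

lemma prod: "r (\<Prod>x\<in>A. f x) = (\<Prod>x\<in>A. r (f x))"
  by (induction A rule: infinite_finite_induct) (simp_all add: one mult)

lemma power: "r (a ^ n) = r a ^ n"
  by (induction n) (simp_all add: one mult)

lemma of_nat: "r (of_nat n) = of_nat n"
  by (induction n) (simp_all add: zero one add)

end

definition fps_map :: "('a::zero \<Rightarrow> 'b::zero) \<Rightarrow> 'a fps \<Rightarrow> 'b fps" where
  "fps_map r a = Abs_fps (\<lambda>n. r (a $ n))"

lemma fps_map_nth [simp]: "fps_map r a $ n = r (a $ n)"
  by (simp add: fps_map_def)

lemma push_fgl_eq_fps_map: "push_fgl r F = fps_map (fps_map r) F"
  by (simp add: push_fgl_def fps_eq_iff)

lemma push_fgl_nth [simp]: "push_fgl r F $ j = fps_map r (F $ j)"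
  by (simp add: push_fgl_eq_fps_map)

lemma push_fgl_comp: "push_fgl (r \<circ> s) F = push_fgl r (push_fgl s F)"
  by (simp add: fps_eq_iff)

context comm_ring_1_hom
begin

lemma hom_fps_map: "comm_ring_1_hom (fps_map r)"
  by unfold_locales (simp_all add: fps_eq_iff add fps_mult_nth sum mult one zero)

lemma fps_map_X: "fps_map r fps_X = fps_X"
  by (simp add: fps_eq_iff one zero)

lemma fps_map_const: "fps_map r (fps_const c) = fps_const (r c)"
  by (simp add: fps_eq_iff zero)

lemma fps_map_deriv: "fps_map r (fps_deriv a) = fps_deriv (fps_map r a)"
  by (simp add: fps_eq_iff mult add one of_nat)

lemma fps_map_compose: "fps_map r (a oo b) = fps_map r a oo fps_map r b"
proof -
  interpret R: comm_ring_1_hom "fps_map r" by (rule hom_fps_map)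
  show ?thesis
    by (simp add: fps_eq_iff fps_compose_nth sum mult flip: R.power)
qed

text \<open>Each coefficient of a substitution is a finite sum of products, and a ring homomorphism
  passes through it. The same reason serves the next two lemmas.\<close>

lemma push_subst_1_2:
  "fps_map (fps_map r) (subst_1_2 g u) = subst_1_2 (fps_map r g) (fps_map (fps_map r) u)"
proof -
  interpret R: comm_ring_1_hom "fps_map r" by (rule hom_fps_map)
  interpret R2: comm_ring_1_hom "fps_map (fps_map r)" by (rule R.hom_fps_map)
  show ?thesis
    by (simp add: fps_eq_iff subst_1_2_def sum mult flip: R2.power)
qed

lemma push_subst_2_2:
  "fps_map (fps_map r) (subst_2_2 F u v) =
     subst_2_2 (fps_map (fps_map r) F) (fps_map (fps_map r) u) (fps_map (fps_map r) v)"
proof -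
  interpret R: comm_ring_1_hom "fps_map r" by (rule hom_fps_map)
  interpret R2: comm_ring_1_hom "fps_map (fps_map r)" by (rule R.hom_fps_map)
  show ?thesis
    by (simp add: fps_eq_iff subst_2_2_def sum mult flip: R2.power R2.mult)
qed

lemma push_subst_2_3:
  "fps_map (fps_map (fps_map r)) (subst_2_3 F u v) =
     subst_2_3 (fps_map (fps_map r) F)
       (fps_map (fps_map (fps_map r)) u) (fps_map (fps_map (fps_map r)) v)"
proof -
  interpret R: comm_ring_1_hom "fps_map r" by (rule hom_fps_map)
  interpret R2: comm_ring_1_hom "fps_map (fps_map r)" by (rule R.hom_fps_map)
  interpret R3: comm_ring_1_hom "fps_map (fps_map (fps_map r))" by (rule R2.hom_fps_map)
  show ?thesis
    by (simp add: fps_eq_iff subst_2_3_def sum mult flip: R3.power R3.mult)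
qed

lemma formal_group_law_push:
  assumes "formal_group_law F"
  shows "formal_group_law (push_fgl r F)"
proof -
  interpret R: comm_ring_1_hom "fps_map r" by (rule hom_fps_map)
  interpret R2: comm_ring_1_hom "fps_map (fps_map r)" by (rule R.hom_fps_map)
  have F: "F $ 0 = fps_X" "Abs_fps (\<lambda>j. F $ j $ 0) = fps_X" "\<And>i j. F $ j $ i = F $ i $ j"
    and assoc: "subst_2_3 F (subst_2_3 F X3 Y3) Z3 = subst_2_3 F X3 (subst_2_3 F Y3 Z3)"
    using assms by (auto simp: formal_group_law_def)
  have "Abs_fps (\<lambda>j. push_fgl r F $ j $ 0) = fps_map r (Abs_fps (\<lambda>j. F $ j $ 0))"
    by (simp add: fps_eq_iff)
  moreover have "subst_2_3 (push_fgl r F) (subst_2_3 (push_fgl r F) X3 Y3) Z3 =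
      subst_2_3 (push_fgl r F) X3 (subst_2_3 (push_fgl r F) Y3 Z3)"
    using arg_cong[OF assoc, of "fps_map (fps_map (fps_map r))"]
    by (simp add: push_subst_2_3 push_fgl_eq_fps_map fps_map_X fps_map_const
        R.fps_map_X R.fps_map_const R2.fps_map_X R2.fps_map_const)
  ultimately show ?thesis
    using F by (simp add: formal_group_law_def fps_map_X)
qed

text \<open>All conditions are identities between coefficients. Applied to \<open>nu_MU\<close> and
  the Krichever-Hoehn genus, this gives part (i).\<close>

lemma strict_iso_push:
  assumes "strict_iso F G \<nu>"
  shows "strict_iso (push_fgl r F) (push_fgl r G) (fps_map r \<nu>)"
proof -
  interpret R: comm_ring_1_hom "fps_map r" by (rule hom_fps_map)
  have iso: "subst_1_2 \<nu> F = subst_2_2 G (subst_1_2 \<nu> X2) (subst_1_2 \<nu> Y2)"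
    using assms by (simp add: strict_iso_def)
  have "formal_group_law (push_fgl r F)" "formal_group_law (push_fgl r G)"
    using assms by (simp_all add: strict_iso_def formal_group_law_push)
  moreover have "subst_1_2 (fps_map r \<nu>) (push_fgl r F) =
      subst_2_2 (push_fgl r G) (subst_1_2 (fps_map r \<nu>) X2) (subst_1_2 (fps_map r \<nu>) Y2)"
    using arg_cong[OF iso, of "fps_map (fps_map r)"]
    by (simp add: push_subst_1_2 push_subst_2_2 push_fgl_eq_fps_map
        fps_map_X fps_map_const R.fps_map_X R.fps_map_const)
  ultimately show ?thesis
    using assms by (simp add: strict_iso_def zero one)
qed

end


section \<open>The invariant differential\<close>

text \<open>The inner variable is x, so g(x) is a constant for the outer variable, while g(y) in the
  next lemma is an outer series with scalar coefficients.\<close>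

lemma subst_1_2_X2: "subst_1_2 g X2 = fps_const g"
  by (simp add: fps_eq_iff subst_1_2_def fps_const_power mult_delta_right)

lemma subst_1_2_Y2: "subst_1_2 g Y2 = fps_map fps_const g"
  by (simp add: fps_eq_iff subst_1_2_def if_distrib[of "\<lambda>u. u $ _"] mult_delta_right cong: if_cong)

text \<open>Compares the coefficients of y in \<open>\<nu>(F(x, y)) = G(\<nu>(x), \<nu>(y))\<close>,
  that is, differentiates in y at y = 0. The series \<open>F $ 1\<close> is the partial derivative
  of \<open>F\<close> in y at (x, 0); dx divided by it is the invariant differential.\<close>

lemma strict_iso_invariant_differential:
  assumes "strict_iso F G \<nu>"
  shows "fps_deriv \<nu> * F $ 1 = (G $ 1) oo \<nu>"
proof -
  have \<nu>: "\<nu> $ 0 = 0" "\<nu> $ 1 = 1" and F0: "F $ 0 = fps_X"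
    and iso: "subst_1_2 \<nu> F = subst_2_2 G (fps_const \<nu>) (fps_map fps_const \<nu>)"
    using assms
    by (simp_all add: strict_iso_def formal_group_law_def subst_1_2_X2 subst_1_2_Y2)
  have lhs: "subst_1_2 \<nu> F $ 1 $ i = (fps_deriv \<nu> * F $ 1) $ i" for i
  proof -
    \<comment> \<open>The coefficient of y in \<open>F ^ a\<close> is
      \<open>a * (F $ 0) ^ (a - 1) * F $ 1\<close>, and \<open>F $ 0\<close> is x. The bound
      \<open>Suc i\<close> is the total degree i + 1; the term a = 0 vanishes and is shifted away
      next.\<close>
    have "subst_1_2 \<nu> F $ 1 $ i =
        (\<Sum>a\<le>Suc i. \<nu> $ a * (of_nat a * fps_X ^ (a - 1) * F $ 1) $ i)"
      by (simp add: subst_1_2_def fps_power_first[unfolded One_nat_def] F0)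
    also have "\<dots> = (\<Sum>k\<le>i. \<nu> $ Suc k * (of_nat (Suc k) * fps_X ^ k * F $ 1) $ i)"
      by (subst sum.atMost_Suc_shift) simp
    also have "\<dots> = (\<Sum>k\<le>i. fps_deriv \<nu> $ k * F $ 1 $ (i - k))"
    proof (intro sum.cong refl)
      fix k assume "k \<in> {..i}"
      moreover have "of_nat (Suc k) * fps_X ^ k * F $ 1 =
          fps_const (of_nat (Suc k)) * (fps_X ^ k * F $ 1)"
        by (simp only: fps_of_nat mult.assoc)
      ultimately show "\<nu> $ Suc k * (of_nat (Suc k) * fps_X ^ k * F $ 1) $ i =
          fps_deriv \<nu> $ k * F $ 1 $ (i - k)"
        by (simp only: fps_mult_left_const_nth fps_X_power_mult_nth) (simp add: mult_ac)
    qed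
    finally show ?thesis
      by (simp add: fps_mult_nth atLeast0AtMost)
  qed
  have rhs: "subst_2_2 G (fps_const \<nu>) (fps_map fps_const \<nu>) $ 1 $ i = ((G $ 1) oo \<nu>) $ i" for i
  proof -
    \<comment> \<open>As \<open>\<nu>\<close> starts with y, only its first power has a term linear
      in y.\<close>
    have pow: "(fps_map fps_const \<nu> ^ b) $ 1 = (if b = 1 then 1 else 0)" for b
      unfolding fps_power_first using \<nu> by (cases b) (auto simp: zero_power)
    have "subst_2_2 G (fps_const \<nu>) (fps_map fps_const \<nu>) $ 1 $ i =
        (\<Sum>a\<le>Suc i. \<Sum>b\<le>Suc i. if b = 1 then G $ 1 $ a * (\<nu> ^ a) $ i else 0)"
      unfolding subst_2_2_def fps_nth_Abs_fps
      by (intro sum.cong) (simp_all add: fps_const_power pow[unfolded One_nat_def])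
    also have "\<dots> = (\<Sum>a\<le>Suc i. G $ 1 $ a * (\<nu> ^ a) $ i)"
      by simp
    \<comment> \<open>The last term drops out because \<open>\<nu> ^ a\<close> has no terms below
      degree a.\<close>
    also have "\<dots> = (\<Sum>a\<le>i. G $ 1 $ a * (\<nu> ^ a) $ i)"
      using \<nu> by (simp add: startsby_zero_power_prefix del: power_Suc)
    finally show ?thesis
      by (simp add: fps_compose_nth atLeast0AtMost)
  qed
  show ?thesis
    using lhs rhs iso by (simp add: fps_eq_iff)
qed

text \<open>For the additive law the series \<open>G $ 1\<close> is 1. The resulting equation, with
  zero constant term, characterizes the logarithm over a rational algebra.\<close>

lemma is_logarithm_invariant_differential:
  assumes "is_logarithm F l"
  shows "fps_deriv l * F $ 1 = 1"
  using strict_iso_invariant_differential[of F additive_fgl l] assms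
  by (simp add: is_logarithm_def additive_fgl_def)


section \<open>Homomorphisms between rational polynomial algebras\<close>

lemma Const_0 [simp]: "Const 0 = 0"
  by (simp add: Const_def)

lemma Const_1 [simp]: "Const 1 = 1"
  by (simp add: Const_def)

lemma Const_add: "Const (a + b) = Const a + Const b"
  by (simp add: Const_def single_add)

lemma Const_uminus: "Const (- a) = - Const a"
  by (simp add: Const_def single_uminus)

lemma Const_mult: "Const (a * b) = Const a * Const b"
  by (simp add: Const_def mult_single)

lemma Const_of_nat: "Const (of_nat n) = of_nat n"
  by (simp add: Const_def single_of_nat)

lemma Const_inverse_mult: "c \<noteq> 0 \<Longrightarrow> Const c * (Const (1 / c) * p) = p"
  by (simp add: mult.assoc[symmetric] flip: Const_mult)

lemma rat_alg_hom_Const: "rat_alg_hom r \<Longrightarrow> r (Const c) = Const c"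
  by (simp add: rat_alg_hom_def)

lemma rat_alg_hom_comm_ring_1_hom: "rat_alg_hom r \<Longrightarrow> comm_ring_1_hom r"
  by unfold_locales (auto simp: rat_alg_hom_def simp flip: Const_1)

lemma rat_alg_hom_comp: "rat_alg_hom r \<Longrightarrow> rat_alg_hom s \<Longrightarrow> rat_alg_hom (r \<circ> s)"
  by (simp add: rat_alg_hom_def)

lemma rat_alg_hom_id: "rat_alg_hom id"
  by (simp add: rat_alg_hom_def)

section \<open>Generation of a polynomial algebra by its variables\<close>

lemma poly_mapping_sum_monomials:
  "p = (\<Sum>m\<in>Poly_Mapping.keys p. Poly_Mapping.single m (Poly_Mapping.lookup p m))"
  by (rule poly_mapping_eqI)
    (auto simp: lookup_sum lookup_single when_def in_keys_iff)

lemma Var_power: "Var v ^ n = Poly_Mapping.single (Poly_Mapping.single v n) 1"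
  by (induction n) (simp_all add: Var_def mult_single flip: single_add)

lemma prod_single_1:
  "(\<Prod>v\<in>A. Poly_Mapping.single (f v) 1) = Poly_Mapping.single (\<Sum>v\<in>A. f v) (1::'a::comm_semiring_1)"
  by (induction A rule: infinite_finite_induct) (simp_all add: mult_single)

lemma single_eq_Const_mult_prod:
  "Poly_Mapping.single m c = Const c * (\<Prod>v\<in>Poly_Mapping.keys m. Var v ^ Poly_Mapping.lookup m v)"
  by (simp add: Var_power prod_single_1 Const_def mult_single flip: poly_mapping_sum_monomials)

lemma rat_alg_hom_eqI:
  assumes r: "rat_alg_hom r" and s: "rat_alg_hom s" and Var: "\<And>v. r (Var v) = s (Var v)"
  shows "r = s"
proof
  interpret r: comm_ring_1_hom r by (rule rat_alg_hom_comm_ring_1_hom[OF r])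
  interpret s: comm_ring_1_hom s by (rule rat_alg_hom_comm_ring_1_hom[OF s])
  fix p
  have "r (Poly_Mapping.single m c) = s (Poly_Mapping.single m c)" for m c
    by (simp add: single_eq_Const_mult_prod r.mult s.mult r.prod s.prod r.power s.power Var
        rat_alg_hom_Const[OF r] rat_alg_hom_Const[OF s])
  then show "r p = s p"
    by (subst (1 2) poly_mapping_sum_monomials) (simp add: r.sum s.sum)
qed

section \<open>Evaluation homomorphisms\<close>

definition eval_monom :: "('v \<Rightarrow> 'w qpoly) \<Rightarrow> ('v \<Rightarrow>\<^sub>0 nat) \<Rightarrow> 'w qpoly" where
  "eval_monom g m = (\<Prod>v\<in>Poly_Mapping.keys m. g v ^ Poly_Mapping.lookup m v)"

definition eval_qpoly :: "('v \<Rightarrow> 'w qpoly) \<Rightarrow> 'v qpoly \<Rightarrow> 'w qpoly" where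
  "eval_qpoly g p =
     (\<Sum>m\<in>Poly_Mapping.keys p. Const (Poly_Mapping.lookup p m) * eval_monom g m)"

lemma eval_monom_add: "eval_monom g (m + n) = eval_monom g m * eval_monom g n"
proof -
  \<comment> \<open>The three products run over different key sets; extending them to the union only
    adds factors with exponent 0.\<close>
  have *: "eval_monom g k = (\<Prod>v\<in>Poly_Mapping.keys m \<union> Poly_Mapping.keys n. g v ^ Poly_Mapping.lookup k v)"
    if "Poly_Mapping.keys k \<subseteq> Poly_Mapping.keys m \<union> Poly_Mapping.keys n" for k
    unfolding eval_monom_def using that
    by (intro prod.mono_neutral_left) (auto simp: in_keys_iff)
  show ?thesis
    using *[of m] *[of n] *[OF keys_add[of m n]]
    by (simp add: lookup_add power_add prod.distrib)
qed

lemma eval_qpoly_add: "eval_qpoly g (p + q) = eval_qpoly g p + eval_qpoly g q"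
  unfolding eval_qpoly_def
  by (rule setsum_keys_plus_distrib) (simp_all add: Const_add algebra_simps)

lemma eval_qpoly_sum: "eval_qpoly g (\<Sum>x\<in>A. f x) = (\<Sum>x\<in>A. eval_qpoly g (f x))"
  by (induction A rule: infinite_finite_induct) (simp_all add: eval_qpoly_add, simp_all add: eval_qpoly_def)

lemma eval_qpoly_single: "eval_qpoly g (Poly_Mapping.single m c) = Const c * eval_monom g m"
  by (cases "c = 0") (simp_all add: eval_qpoly_def)

lemma eval_qpoly_mult: "eval_qpoly g (p * q) = eval_qpoly g p * eval_qpoly g q"
proof -
  let ?s = "\<lambda>p m. Poly_Mapping.single m (Poly_Mapping.lookup p m)"
  have "p * q = (\<Sum>m\<in>Poly_Mapping.keys p. \<Sum>n\<in>Poly_Mapping.keys q. ?s p m * ?s q n)"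
    by (subst (1 3) poly_mapping_sum_monomials) (simp add: sum_product)
  then have "eval_qpoly g (p * q) =
      (\<Sum>m\<in>Poly_Mapping.keys p. \<Sum>n\<in>Poly_Mapping.keys q. eval_qpoly g (?s p m) * eval_qpoly g (?s q n))"
    by (simp add: eval_qpoly_sum mult_single eval_qpoly_single eval_monom_add Const_mult mult_ac)
  also have "\<dots> = eval_qpoly g p * eval_qpoly g q"
    by (simp only: eval_qpoly_single) (simp add: eval_qpoly_def sum_product)
  finally show ?thesis .
qed

lemma rat_alg_hom_eval_qpoly: "rat_alg_hom (eval_qpoly g)"
  by (simp add: rat_alg_hom_def eval_qpoly_add eval_qpoly_mult)
    (simp add: Const_def eval_qpoly_single eval_monom_def)

lemma eval_qpoly_Var: "eval_qpoly g (Var v) = g v"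
  by (simp add: Var_def eval_qpoly_single eval_monom_def)


section \<open>Triangular endomorphisms\<close>

text \<open>The subalgebra generated by the variables in \<open>V\<close>. Generation, rather than a
  condition on monomials, lets preimages under a homomorphism be built by rule induction.\<close>

inductive_set qpoly_over :: "'v set \<Rightarrow> 'v qpoly set" for V where
  Const: "Const c \<in> qpoly_over V"
| Var: "v \<in> V \<Longrightarrow> Var v \<in> qpoly_over V"
| add: "p \<in> qpoly_over V \<Longrightarrow> q \<in> qpoly_over V \<Longrightarrow> p + q \<in> qpoly_over V"
| mult: "p \<in> qpoly_over V \<Longrightarrow> q \<in> qpoly_over V \<Longrightarrow> p * q \<in> qpoly_over V"

lemma qpoly_over_mono: "p \<in> qpoly_over V \<Longrightarrow> V \<subseteq> W \<Longrightarrow> p \<in> qpoly_over W"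
  by (induction rule: qpoly_over.induct) (auto intro: qpoly_over.intros)

lemma qpoly_over_0: "0 \<in> qpoly_over V"
  using qpoly_over.Const[of 0] by simp

lemma qpoly_over_1: "1 \<in> qpoly_over V"
  using qpoly_over.Const[of 1] by simp

lemma qpoly_over_sum: "(\<And>x. x \<in> A \<Longrightarrow> f x \<in> qpoly_over V) \<Longrightarrow> (\<Sum>x\<in>A. f x) \<in> qpoly_over V"
  by (induction A rule: infinite_finite_induct) (auto intro: qpoly_over.add qpoly_over_0)

lemma qpoly_over_uminus: "p \<in> qpoly_over V \<Longrightarrow> - p \<in> qpoly_over V"
proof -
  have "- p = Const (- 1) * p"
    by (simp add: Const_uminus)
  then show "p \<in> qpoly_over V \<Longrightarrow> - p \<in> qpoly_over V"
    by (simp add: qpoly_over.Const qpoly_over.mult)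
qed

definition triangular :: "(nat qpoly \<Rightarrow> nat qpoly) \<Rightarrow> bool" where
  "triangular r \<longleftrightarrow> rat_alg_hom r \<and>
     (\<forall>n. \<exists>c b. c \<noteq> 0 \<and> b \<in> qpoly_over {..<n} \<and> r (Var n) = Const c * Var n + b)"

text \<open>Solves \<open>r (Var n) = Const c * Var n + b\<close> for \<open>Var n\<close>: subtract
  a preimage of \<open>b\<close>, then divide by the nonzero rational \<open>c\<close>.\<close>

lemma triangular_preimage_Var:
  assumes "triangular r"
  shows "\<exists>c b. c \<noteq> 0 \<and> b \<in> qpoly_over {..<n} \<and> r (Const c * Var n + b) = Var n"
proof (induction n rule: less_induct)
  case (less n)
  have r: "rat_alg_hom r"
    using assms by (simp add: triangular_def)
  interpret r: comm_ring_1_hom r by (rule rat_alg_hom_comm_ring_1_hom[OF r])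
  \<comment> \<open>The induction hypothesis covers only the earlier variables; it extends to the
    algebra they generate because \<open>r\<close> is a homomorphism.\<close>
  have preimage: "\<exists>s\<in>qpoly_over {..<n}. r s = p" if "p \<in> qpoly_over {..<n}" for p
    using that
  proof (induction rule: qpoly_over.induct)
    case (Const c)
    then show ?case
      by (meson qpoly_over.Const r rat_alg_hom_Const)
  next
    case (Var m)
    then obtain c b where "b \<in> qpoly_over {..<m}" "r (Const c * Var m + b) = Var m"
      using less[of m] by auto
    with Var show ?case
      by (intro bexI[of _ "Const c * Var m + b"])
        (auto intro!: qpoly_over.intros intro: qpoly_over_mono)
  next
    case (add p q)
    then show ?case by (metis r.add qpoly_over.add)
  next
    case (mult p q)
    then show ?case by (metis r.mult qpoly_over.mult)
  qed
  obtain c b where c: "c \<noteq> 0" and b: "b \<in> qpoly_over {..<n}" and rn: "r (Var n) = Const c * Var n + b"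
    using assms unfolding triangular_def by blast
  obtain s where s: "s \<in> qpoly_over {..<n}" "r s = - b"
    using preimage qpoly_over_uminus[OF b] by blast
  have "r (Const (1 / c) * Var n + Const (1 / c) * s) = Const (1 / c) * (r (Var n) + r s)"
    by (simp add: r.add r.mult rat_alg_hom_Const[OF r] algebra_simps)
  also have "\<dots> = Var n"
    using c by (simp add: rn s mult.assoc[symmetric] flip: Const_mult)
  finally show ?case
    using c s by (intro exI[of _ "1 / c"] exI[of _ "Const (1 / c) * s"])
      (simp add: qpoly_over.Const qpoly_over.mult)
qed

text \<open>The section sends each variable to the preimage just found. That it is again triangular
  allows the construction to be repeated.\<close>

lemma triangular_section:
  assumes "triangular r"
  obtains s where "triangular s" "r \<circ> s = id"
proof -
  have "\<forall>n. \<exists>c b. c \<noteq> 0 \<and> b \<in> qpoly_over {..<n} \<and> r (Const c * Var n + b) = Var n"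
    using triangular_preimage_Var[OF assms] by blast
  then obtain c b where *:
    "\<And>n. c n \<noteq> 0" "\<And>n. b n \<in> qpoly_over {..<n}" "\<And>n. r (Const (c n) * Var n + b n) = Var n"
    by metis
  let ?s = "eval_qpoly (\<lambda>n. Const (c n) * Var n + b n)"
  have "triangular ?s"
    using * by (auto simp: triangular_def rat_alg_hom_eval_qpoly eval_qpoly_Var)
  moreover have "r \<circ> ?s = id"
    using assms * by (intro rat_alg_hom_eqI rat_alg_hom_comp rat_alg_hom_eval_qpoly rat_alg_hom_id)
      (auto simp: triangular_def eval_qpoly_Var)
  ultimately show thesis by (rule that)
qed

lemma triangular_bij:
  assumes "triangular r"
  shows "bij r"
proof -
  obtain s where s: "triangular s" "r \<circ> s = id"
    using triangular_section[OF assms] .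
  obtain u where u: "s \<circ> u = id"
    using triangular_section[OF s(1)] .
  \<comment> \<open>Both equal \<open>r \<circ> s \<circ> u\<close>, so \<open>s\<close> is a
    two-sided inverse of \<open>r\<close>.\<close>
  have "r = u"
    by (metis comp_assoc comp_id id_comp s(2) u)
  then show ?thesis
    using s u by (metis o_bij)
qed


section \<open>Logarithms over rational polynomial algebras\<close>

text \<open>The coefficients do not form a field, but they contain the rationals, so the factor
  \<open>Suc k\<close> cancels.\<close>

lemma qpoly_fps_deriv_eqD:
  fixes a b :: "'v qpoly fps"
  assumes "fps_deriv a = fps_deriv b" and "a $ 0 = b $ 0"
  shows "a = b"
proof (rule fps_ext)
  fix n
  show "a $ n = b $ n"
  proof (cases n)
    case (Suc k)
    have "of_nat (Suc k) * a $ Suc k = of_nat (Suc k) * b $ Suc k"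
      using arg_cong[OF assms(1), of "\<lambda>u. u $ k"] by (simp add: mult_ac)
    then have "Const (1 / of_nat (Suc k)) * (Const (of_nat (Suc k)) * a $ Suc k) =
        Const (1 / of_nat (Suc k)) * (Const (of_nat (Suc k)) * b $ Suc k)"
      by (simp only: Const_of_nat)
    then show ?thesis
      by (simp add: Suc mult.assoc[symmetric] flip: Const_mult)
  qed (simp add: assms)
qed

lemma qpoly_fps_deriv_inverse_unique:
  fixes l m :: "'v qpoly fps"
  assumes l: "fps_deriv l * w = 1" and m: "fps_deriv m * w = 1" and "l $ 0 = 0" "m $ 0 = 0"
  shows "l = m"
proof (rule qpoly_fps_deriv_eqD)
  have "fps_deriv l = fps_deriv l * (fps_deriv m * w)"
    by (simp add: m)
  also have "\<dots> = fps_deriv m * (fps_deriv l * w)"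
    by (simp add: mult_ac)
  finally show "fps_deriv l = fps_deriv m"
    by (simp add: l)
qed (simp add: assms)

lemma log_MU_nth_0: "log_MU $ 0 = 0"
  by (simp add: log_MU_def)

lemma log_MU_nth_Suc: "log_MU $ Suc i = Const (1 / of_nat (Suc i)) * CP i"
  by (simp add: log_MU_def)

lemma fps_deriv_log_MU: "fps_deriv log_MU = Abs_fps CP"
proof (rule fps_ext)
  fix n
  have "fps_deriv log_MU $ n = of_nat (Suc n) * (Const (1 / of_nat (Suc n)) * CP n)"
    by (simp add: log_MU_nth_Suc)
  also have "\<dots> = Const (of_nat (Suc n)) * (Const (1 / of_nat (Suc n)) * CP n)"
    by (simp only: Const_of_nat)
  also have "\<dots> = Abs_fps CP $ n"
    by (simp only: Const_inverse_mult of_nat_eq_0_iff nat.simps fps_nth_Abs_fps not_False_eq_True)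
  finally show "fps_deriv log_MU $ n = Abs_fps CP $ n" .
qed

lemma nu_MU_eq: "nu_MU = fps_X * fps_deriv log_MU"
  by (auto simp: nu_MU_def fps_deriv_log_MU fps_eq_iff)

lemma nu_MU_nth_0: "nu_MU $ 0 = 0"
  by (simp add: nu_MU_eq)

lemma nu_MU_nth_Suc: "nu_MU $ Suc i = CP i"
  by (simp add: nu_MU_eq fps_deriv_log_MU)

lemma log_push_universal:
  assumes "is_universal_fgl F" and "rat_alg_hom r"
  shows "fps_deriv (fps_map r log_MU) * push_fgl r F $ 1 = 1"
proof -
  interpret r: comm_ring_1_hom r by (rule rat_alg_hom_comm_ring_1_hom) fact
  interpret R: comm_ring_1_hom "fps_map r" by (rule r.hom_fps_map)
  have "fps_deriv log_MU * F $ 1 = 1"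
    using assms(1) unfolding is_universal_fgl_def by (rule is_logarithm_invariant_differential)
  from arg_cong[OF this, of "fps_map r"] show ?thesis
    by (simp add: R.mult R.one flip: r.fps_map_deriv)
qed

text \<open>Both series solve \<open>l' * w = 1\<close> with \<open>w = push_fgl r F $ 1\<close> and
  zero constant term.\<close>

lemma logarithm_push_universal:
  assumes "is_universal_fgl F" and r: "rat_alg_hom r" and l: "is_logarithm (push_fgl r F) l"
  shows "l = fps_map r log_MU"
proof (rule qpoly_fps_deriv_inverse_unique)
  interpret r: comm_ring_1_hom r by (rule rat_alg_hom_comm_ring_1_hom[OF r])
  show "fps_map r log_MU $ 0 = 0"
    by (simp add: log_MU_nth_0 r.zero)
  show "l $ 0 = 0"
    using l by (simp add: is_logarithm_def strict_iso_def)
qed (rule is_logarithm_invariant_differential[OF l] log_push_universal[OF assms(1,2)])+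

text \<open>The generator \<open>Var n\<close> can be read off, up to the factor 1 / (n + 2), as the
  coefficient of \<open>x ^ (n + 2)\<close> in \<open>log_MU\<close>.\<close>

lemma rat_alg_hom_eq_if_log_eq:
  assumes r: "rat_alg_hom r" and s: "rat_alg_hom s"
    and eq: "fps_map r log_MU = fps_map s log_MU"
  shows "r = s"
proof (rule rat_alg_hom_eqI[OF r s])
  interpret r: comm_ring_1_hom r by (rule rat_alg_hom_comm_ring_1_hom[OF r])
  interpret s: comm_ring_1_hom s by (rule rat_alg_hom_comm_ring_1_hom[OF s])
  fix n
  let ?c = "of_nat (Suc (Suc n)) :: rat"
  have "r (log_MU $ Suc (Suc n)) = s (log_MU $ Suc (Suc n))"
    using arg_cong[OF eq, of "\<lambda>u. u $ Suc (Suc n)"] by simp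
  then have "Const ?c * (Const (1 / ?c) * r (Var n)) = Const ?c * (Const (1 / ?c) * s (Var n))"
    by (simp only: log_MU_nth_Suc r.mult s.mult rat_alg_hom_Const[OF r] rat_alg_hom_Const[OF s] CP.simps)
  then show "r (Var n) = s (Var n)"
    by (simp only: Const_inverse_mult of_nat_eq_0_iff nat.simps not_False_eq_True)
qed


section \<open>The classifying map of the twisted formal group law\<close>

text \<open>Both sides solve \<open>l' * F $ 1 = 1\<close>. For the left side, the chain rule and
  the invariant differential of \<open>nu_MU\<close> reduce this to the equation for the image of
  \<open>log_MU\<close> and \<open>F'\<close>, composed with \<open>nu_MU\<close>.\<close>

lemma classifying_map_log_compose_nu:
  assumes F: "is_universal_fgl F" and iso: "strict_iso F F' nu_MU"
    and \<kappa>: "is_classifying_map F F' \<kappa>"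
  shows "fps_map \<kappa> log_MU oo nu_MU = log_MU"
proof (rule qpoly_fps_deriv_inverse_unique)
  let ?m = "fps_map \<kappa> log_MU"
  have hom: "rat_alg_hom \<kappa>" and push: "push_fgl \<kappa> F = F'"
    using \<kappa> by (auto simp: is_classifying_map_def)
  interpret \<kappa>: comm_ring_1_hom \<kappa> by (rule rat_alg_hom_comm_ring_1_hom[OF hom])
  have "fps_deriv (?m oo nu_MU) * F $ 1 = (fps_deriv ?m oo nu_MU) * (fps_deriv nu_MU * F $ 1)"
    by (simp add: fps_compose_deriv nu_MU_nth_0 mult.assoc)
  also have "\<dots> = (fps_deriv ?m * F' $ 1) oo nu_MU"
    using strict_iso_invariant_differential[OF iso]
    by (simp add: fps_compose_mult_distrib nu_MU_nth_0)
  also have "\<dots> = 1"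
    using log_push_universal[OF F hom] by (simp add: push)
  finally show "fps_deriv (?m oo nu_MU) * F $ 1 = 1" .
  show "fps_deriv log_MU * F $ 1 = 1"
    using F unfolding is_universal_fgl_def by (rule is_logarithm_invariant_differential)
  show "(?m oo nu_MU) $ 0 = 0" "log_MU $ 0 = 0"
    by (simp_all add: log_MU_nth_0 \<kappa>.zero)
qed

lemma CP_in_qpoly_over: "CP k \<in> qpoly_over {..<k}"
  by (cases k) (auto intro: qpoly_over.Var qpoly_over_1)

text \<open>Only \<open>CP i\<close> with i \<le> k can occur, and \<open>CP i\<close> is the
  variable of index i - 1 or the constant 1.\<close>

lemma CP_series_power_nth_in: "(Abs_fps CP ^ a) $ k \<in> qpoly_over {..<k}"
proof (induction a arbitrary: k)
  case 0
  then show ?case by (simp add: qpoly_over_0 qpoly_over_1)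
next
  case (Suc a)
  have "CP i * (Abs_fps CP ^ a) $ (k - i) \<in> qpoly_over {..<k}" if "i \<le> k" for i
    using that qpoly_over_mono[OF CP_in_qpoly_over, of i "{..<k}"]
      qpoly_over_mono[OF Suc, of "k - i" "{..<k}"]
    by (auto intro: qpoly_over.mult)
  then show ?case
    by (auto simp: fps_mult_nth intro: qpoly_over_sum)
qed

lemma nu_MU_power_nth: "(nu_MU ^ a) $ k = (if k < a then 0 else (Abs_fps CP ^ a) $ (k - a))"
  by (simp add: nu_MU_eq fps_deriv_log_MU power_mult_distrib fps_X_power_mult_nth)

text \<open>
  In the coefficient of \<open>x ^ (n + 2)\<close> of \<open>fps_map \<kappa> log_MU oo nu_MU = log_MU\<close>, the generator
  \<open>Var n\<close> occurs as \<open>\<kappa> (Var n) / (n + 2)\<close>, as \<open>Var n\<close> from the linear term of the logarithm, and as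
  \<open>Var n / (n + 2)\<close> on the right.
\<close>

lemma classifying_map_triangular:
  assumes hom: "rat_alg_hom \<kappa>" and log: "fps_map \<kappa> log_MU oo nu_MU = log_MU"
  shows "triangular \<kappa>"
proof -
  interpret \<kappa>: comm_ring_1_hom \<kappa> by (rule rat_alg_hom_comm_ring_1_hom[OF hom])
  \<comment> \<open>Clearing the factor 1 / (n + 2) leaves the leading coefficient 1 - (n + 2),
    which is never zero.\<close>
  have step: "\<exists>b \<in> qpoly_over {..<n}. \<kappa> (Var n) = Const (- of_nat (Suc n)) * Var n + b" for n
  proof (induction n rule: less_induct)
    case (less n)
    have Var: "\<kappa> (Var m) \<in> qpoly_over {..<n}" if m: "m < n" for m
    proof -
      obtain b where "b \<in> qpoly_over {..<m}" "\<kappa> (Var m) = Const (- of_nat (Suc m)) * Var m + b"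
        using less[OF m] by blast
      with m show ?thesis
        by (auto intro!: qpoly_over.intros intro: qpoly_over_mono)
    qed
    let ?c = "of_nat (Suc (Suc n)) :: rat"
    let ?f = "\<lambda>a. \<kappa> (log_MU $ a) * (nu_MU ^ a) $ Suc (Suc n)"
    \<comment> \<open>The terms with exponents 2 to n + 1. They involve
      \<open>\<kappa> (Var a)\<close> only for a < n, and coefficients of
      \<open>nu_MU ^ (a + 2)\<close> lying over the first n - a variables.\<close>
    define b where "b = (\<Sum>a<n. ?f (Suc (Suc a)))"
    have "?f (Suc (Suc a)) \<in> qpoly_over {..<n}" if "a < n" for a
    proof -
      have "(nu_MU ^ Suc (Suc a)) $ Suc (Suc n) \<in> qpoly_over {..<n}"
        using that qpoly_over_mono[OF CP_series_power_nth_in, of "n - a" "{..<n}"]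
        by (simp add: nu_MU_power_nth del: power_Suc)
      with Var[OF that] show ?thesis
        by (simp add: log_MU_nth_Suc \<kappa>.mult rat_alg_hom_Const[OF hom] qpoly_over.Const qpoly_over.mult
            del: power_Suc of_nat_Suc)
    qed
    then have b: "b \<in> qpoly_over {..<n}"
      by (auto simp: b_def intro: qpoly_over_sum)
    have "Const (1 / ?c) * Var n = log_MU $ Suc (Suc n)"
      by (simp only: log_MU_nth_Suc CP.simps)
    also have "\<dots> = (\<Sum>a\<le>Suc (Suc n). ?f a)"
      by (subst log[symmetric]) (simp only: fps_compose_nth fps_map_nth atLeast0AtMost)
    also have "\<dots> = ?f 0 + (?f 1 + (\<Sum>a<Suc n. ?f (Suc (Suc a))))"
      by (simp only: sum.lessThan_Suc_shift One_nat_def flip: lessThan_Suc_atMost)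
    also have "\<dots> = ?f 0 + (?f 1 + (b + ?f (Suc (Suc n))))"
      by (simp only: b_def sum.lessThan_Suc)
    also have "?f 0 = 0"
      by simp
    also have "?f 1 = Var n"
      by (simp add: log_MU_nth_Suc \<kappa>.one nu_MU_nth_Suc)
    also have "?f (Suc (Suc n)) = Const (1 / ?c) * \<kappa> (Var n)"
      by (simp add: log_MU_nth_Suc nu_MU_power_nth fps_power_zeroth \<kappa>.mult rat_alg_hom_Const[OF hom]
          del: power_Suc of_nat_Suc)
    finally have "Const (1 / ?c) * \<kappa> (Var n) = Const (1 / ?c) * Var n - Var n - b"
      by (simp add: algebra_simps)
    then have "Const ?c * (Const (1 / ?c) * \<kappa> (Var n)) =
        Const ?c * (Const (1 / ?c) * Var n) - Const ?c * Var n - Const ?c * b"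
      by (simp only: right_diff_distrib)
    then have "\<kappa> (Var n) = Var n - Const ?c * Var n - Const ?c * b"
      by (simp only: Const_inverse_mult of_nat_eq_0_iff nat.simps not_False_eq_True)
    also have "\<dots> = Const (1 + - ?c) * Var n + - (Const ?c * b)"
      by (simp only: Const_add Const_uminus Const_1) (simp add: algebra_simps del: of_nat_Suc)
    also have "1 + - ?c = - of_nat (Suc n)"
      by simp
    finally show ?case
      using b by (intro bexI[of _ "- (Const ?c * b)"])
        (auto intro: qpoly_over.mult qpoly_over.Const qpoly_over_uminus)
  qed
  show ?thesis
    unfolding triangular_def
  proof (intro conjI allI hom)
    fix n
    obtain b where "b \<in> qpoly_over {..<n}" "\<kappa> (Var n) = Const (- of_nat (Suc n)) * Var n + b"
      using step by blast
    then show "\<exists>c b. c \<noteq> 0 \<and> b \<in> qpoly_over {..<n} \<and> \<kappa> (Var n) = Const c * Var n + b"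
      by (intro exI[of _ "- of_nat (Suc n)"] exI[of _ b]) (simp del: of_nat_Suc)
  qed
qed


section \<open>The Krichever--Hoehn equation\<close>

text \<open>
  A linear order on the variables makes the library's instance of \<^class>\<open>idom\<close> available for
  \<^typ>\<open>qvar qpoly\<close>.
\<close>

instantiation qvar :: linorder
begin

definition less_eq_qvar :: "qvar \<Rightarrow> qvar \<Rightarrow> bool" where
  "x \<le> y \<longleftrightarrow> deg_q x \<le> deg_q y"

definition less_qvar :: "qvar \<Rightarrow> qvar \<Rightarrow> bool" where
  "x < y \<longleftrightarrow> deg_q x < deg_q y"

instance
proof
  fix x y :: qvar
  show "x \<le> y \<Longrightarrow> y \<le> x \<Longrightarrow> x = y"
    by (cases x; cases y) (simp_all add: less_eq_qvar_def)
qed (auto simp: less_eq_qvar_def less_qvar_def)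

end

text \<open>The reversed quartic \<open>y ^ 4 * S(1 / y)\<close>, which appears when h is replaced
  by 1 / h.\<close>

definition quartic_q :: "qvar qpoly fps" where
  "quartic_q = 1 + fps_const (Var Q1) * fps_X + fps_const (Var Q2) * fps_X ^ 2
     + fps_const (Var Q3) * fps_X ^ 3 + fps_const (Var Q4) * fps_X ^ 4"

lemma rename_iso_quartic:
  assumes "is_rename_iso t"
  shows "fps_map t quartic_p = quartic_q"
proof -
  have hom: "rat_alg_hom t"
    using assms by (simp add: is_rename_iso_def)
  interpret t: comm_ring_1_hom t by (rule rat_alg_hom_comm_ring_1_hom[OF hom])
  interpret T: comm_ring_1_hom "fps_map t" by (rule t.hom_fps_map)
  show ?thesis
    using assms
    by (simp add: quartic_p_def quartic_q_def is_rename_iso_def T.add T.mult T.power T.one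
        t.fps_map_X t.fps_map_const)
qed

lemma quartic_q_compose:
  assumes "g $ 0 = 0"
  shows "quartic_q oo g = 1 + fps_const (Var Q1) * g + fps_const (Var Q2) * g ^ 2
     + fps_const (Var Q3) * g ^ 3 + fps_const (Var Q4) * g ^ 4"
  using assms by (simp add: quartic_q_def fps_compose_add_distrib fps_compose_mult_distrib
      flip: fps_compose_power)

text \<open>With u = 1 / h one has \<open>u' = - h' * u ^ 2\<close>, so
  \<open>u' ^ 2 = S(h) * u ^ 4\<close> is the reversed quartic at u. The computation takes place in
  Laurent series because h has a pole.\<close>

lemma deriv_inverse_of_quartic_solution:
  assumes ode: "(fls_deriv h) ^ 2 = S_quartic h" and inv: "h * fps_to_fls g = 1"
    and g0: "g $ 0 = 0"
  shows "(fps_deriv g) ^ 2 = quartic_q oo g"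
proof -
  define u where "u = fps_to_fls g"
  have hu: "h * u = 1"
    using inv by (simp add: u_def)
  \<comment> \<open>Differentiating \<open>h * u = 1\<close> replaces the quotient rule over
    coefficients that are not a field.\<close>
  have "fls_deriv (h * u) = 0"
    by (simp only: hu fls_deriv_one)
  then have d: "h * fls_deriv u = - (fls_deriv h * u)"
    by (simp add: eq_neg_iff_add_eq_0)
  have "fls_deriv u = (h * u) * fls_deriv u"
    by (simp add: hu)
  also have "\<dots> = u * (h * fls_deriv u)"
    by (simp only: mult_ac)
  also have "\<dots> = - (fls_deriv h * u ^ 2)"
    by (simp only: d) (simp add: mult_ac power2_eq_square)
  finally have "(fls_deriv u) ^ 2 = (fls_deriv h) ^ 2 * u ^ 4"
    by (simp add: power_mult_distrib flip: power_mult)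
  also have "\<dots> = S_quartic h * u ^ 4"
    by (simp add: ode)
  also have "\<dots> = (h * u) ^ 4 + fls_const (Var Q1) * ((h * u) ^ 3 * u)
      + fls_const (Var Q2) * ((h * u) ^ 2 * u ^ 2)
      + fls_const (Var Q3) * (h * u * u ^ 3) + fls_const (Var Q4) * u ^ 4"
    unfolding S_quartic_def by algebra
  also have "\<dots> = 1 + fls_const (Var Q1) * u + fls_const (Var Q2) * u ^ 2
      + fls_const (Var Q3) * u ^ 3 + fls_const (Var Q4) * u ^ 4"
    by (simp add: hu)
  also have "\<dots> = fps_to_fls (quartic_q oo g)"
    by (simp add: quartic_q_compose[OF g0] u_def fls_times_fps_to_fls fps_to_fls_power)
  finally have "fps_to_fls ((fps_deriv g) ^ 2) = fps_to_fls (quartic_q oo g)"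
    by (simp add: u_def fls_deriv_fps_to_fls fps_to_fls_power)
  then show ?thesis by simp
qed

text \<open>Separation of variables: from \<open>g' = s oo g\<close> and \<open>M' * s = 1\<close>
  the chain rule gives \<open>(M oo g)' = 1\<close>, so \<open>M oo g\<close> is x.\<close>

lemma krichever_elliptic_logarithm:
  assumes ode: "(fls_deriv h) ^ 2 = S_quartic h"
    and h: "h * fps_to_fls f = fps_to_fls (fps_deriv f)"
    and f0: "f $ 0 = 0" and L1: "L $ 1 = 1" and Lf: "L oo f = fps_X"
    and s: "s $ 0 = 1" "s ^ 2 = quartic_q"
    and M: "M $ 0 = 0" "fps_deriv M * s = 1"
  shows "M oo (fps_X * fps_deriv L) = L"
proof -
  define g where "g = (fps_X * fps_deriv L) oo f"
  \<comment> \<open>This identifies \<open>fps_deriv L oo f\<close> with 1 / f', hence g with f / f'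
    = 1 / h.\<close>
  have f': "(fps_deriv L oo f) * fps_deriv f = 1"
    using arg_cong[OF Lf, of fps_deriv] f0 by (simp add: fps_compose_deriv)
  have f1: "f $ 1 = 1"
    using arg_cong[OF f', of "\<lambda>u. u $ 0"] L1 by simp
  have g_eq: "g = f * (fps_deriv L oo f)"
    using f0 by (simp add: g_def fps_compose_mult_distrib)
  have g0: "g $ 0 = 0"
    using f0 by (simp add: g_eq)
  have g1: "fps_deriv g $ 0 = 1"
    using f0 f1 L1 by (simp add: g_eq)
  have "h * fps_to_fls g = fps_to_fls ((fps_deriv L oo f) * fps_deriv f)"
    using h by (simp add: g_eq fls_times_fps_to_fls mult_ac)
  then have "h * fps_to_fls g = 1"
    by (simp add: f')
  then have "(fps_deriv g) ^ 2 = quartic_q oo g"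
    by (rule deriv_inverse_of_quartic_solution[OF ode _ g0])
  also have "\<dots> = (s oo g) ^ 2"
    using g0 s by (simp add: fps_compose_power)
  finally have "fps_deriv g = s oo g \<or> fps_deriv g = - (s oo g)"
    by (simp add: power2_eq_iff)
  \<comment> \<open>The sign of the square root is decided by the constant terms, both equal to
    1.\<close>
  moreover have "fps_deriv g \<noteq> - (s oo g)"
  proof
    assume "fps_deriv g = - (s oo g)"
    from arg_cong[OF this, of "\<lambda>u. u $ 0"] have "(1 :: qvar qpoly) = - 1"
      using g1 s by simp
    then show False by simp
  qed
  ultimately have "fps_deriv (M oo g) = (fps_deriv M * s) oo g"
    using g0 by (simp add: fps_compose_deriv fps_compose_mult_distrib)
  then have "fps_deriv (M oo g) = fps_deriv fps_X"
    by (simp add: M)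
  then have "M oo g = fps_X"
    by (rule qpoly_fps_deriv_eqD) (simp add: M)
  \<comment> \<open>Both sides equal x; \<open>f\<close> has linear coefficient 1 and can be
    cancelled on the right.\<close>
  then have "(M oo (fps_X * fps_deriv L)) oo f = L oo f"
    using f0 by (simp add: Lf g_def fps_compose_assoc)
  then show ?thesis
    using f0 f1 by (subst (asm) fps_compose_inj_right) auto
qed

theorem theorem1p1:
  fixes F F' :: "MUQ fps2"
    and \<kappa> :: "MUQ \<Rightarrow> MUQ"
    and \<psi> :: "MUQ \<Rightarrow> pvar qpoly"
    and \<phi>KH :: "MUQ \<Rightarrow> qvar qpoly"
    and t :: "pvar qpoly \<Rightarrow> qvar qpoly"
  assumes "is_universal_fgl F"
    and "strict_iso F F' nu_MU"
    and "is_classifying_map F F' \<kappa>"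
    and "is_psi F \<psi>"
    and "is_Krichever_Hoehn F \<phi>KH"
    and "is_rename_iso t"
  shows "strict_iso (push_fgl \<phi>KH F) (push_fgl (t \<circ> \<psi>) F)
           (Abs_fps (\<lambda>n. case n of 0 \<Rightarrow> 0 | Suc i \<Rightarrow> \<phi>KH (CP i)))
         \<and> bij \<kappa> \<and> \<phi>KH = t \<circ> \<psi> \<circ> inv \<kappa>"
proof -
  have hom: "rat_alg_hom \<kappa>" "rat_alg_hom \<psi>" "rat_alg_hom \<phi>KH" "rat_alg_hom t"
    using assms(3-6)
    by (auto simp: is_classifying_map_def is_psi_def is_Krichever_Hoehn_def is_rename_iso_def)
  interpret \<phi>: comm_ring_1_hom \<phi>KH by (rule rat_alg_hom_comm_ring_1_hom) fact
  interpret \<Phi>: comm_ring_1_hom "fps_map \<phi>KH" by (rule \<phi>.hom_fps_map)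
  interpret t: comm_ring_1_hom t by (rule rat_alg_hom_comm_ring_1_hom) fact
  interpret T: comm_ring_1_hom "fps_map t" by (rule t.hom_fps_map)
  define L where "L = fps_map \<phi>KH log_MU"
  define M where "M = fps_map (t \<circ> \<psi>) log_MU"

  have log: "fps_map \<kappa> log_MU oo nu_MU = log_MU"
    using classifying_map_log_compose_nu assms(1-3) .
  have bij: "bij \<kappa>"
    using triangular_bij classifying_map_triangular hom(1) log by blast

  have \<nu>: "fps_map \<phi>KH nu_MU = fps_X * fps_deriv L"
    by (simp add: nu_MU_eq L_def \<Phi>.mult \<phi>.fps_map_X \<phi>.fps_map_deriv)
  have L1: "L $ 1 = 1"
    by (simp add: L_def log_MU_nth_Suc \<phi>.one)
  have "M oo (fps_X * fps_deriv L) = L"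
  proof -
    obtain f h l where f: "is_logarithm (push_fgl \<phi>KH F) l" "f $ 0 = 0" "l oo f = fps_X"
      and h: "h * fps_to_fls f = fps_to_fls (fps_deriv f)" "(fls_deriv h) ^ 2 = S_quartic h"
      using assms(5) by (auto simp: is_Krichever_Hoehn_def is_exponential_def)
    obtain m s where m: "is_logarithm (push_fgl \<psi> F) m" "m $ 0 = 0"
      and s: "s $ 0 = 1" "s ^ 2 = quartic_p" "fps_deriv m * s = 1"
      using assms(4) by (auto simp: is_psi_def is_elliptic_integral_def)
    have l_eq: "l = L"
      unfolding L_def by (rule logarithm_push_universal[OF assms(1) hom(3) f(1)])
    \<comment> \<open>The elliptic integral is the logarithm of the law for \<open>\<psi>\<close>,
      so uniqueness identifies it with the image of \<open>log_MU\<close> before \<open>t\<close> is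
      applied.\<close>
    have m_eq: "fps_map t m = M"
      using logarithm_push_universal[OF assms(1) hom(2) m(1)] by (simp add: M_def fps_eq_iff)
    show ?thesis
    proof (rule krichever_elliptic_logarithm[OF h(2,1) f(2) L1])
      show "L oo f = fps_X"
        using f(3) l_eq by simp
      show "fps_map t s $ 0 = 1"
        by (simp add: s t.one)
      show "(fps_map t s) ^ 2 = quartic_q"
        by (simp add: s rename_iso_quartic[OF assms(6)] flip: T.power)
      show "M $ 0 = 0"
        by (simp add: m t.zero flip: m_eq)
      show "fps_deriv M * fps_map t s = 1"
        by (simp add: s T.one flip: m_eq t.fps_map_deriv T.mult)
    qed
  qed
  moreover have "fps_map (\<phi>KH \<circ> \<kappa>) log_MU oo (fps_X * fps_deriv L) = L"
  proof -
    have "fps_map (\<phi>KH \<circ> \<kappa>) log_MU = fps_map \<phi>KH (fps_map \<kappa> log_MU)"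
      by (simp add: fps_eq_iff)
    then show ?thesis
      using arg_cong[OF log, of "fps_map \<phi>KH"] by (simp add: \<phi>.fps_map_compose \<nu> L_def)
  qed
  ultimately have "fps_map (\<phi>KH \<circ> \<kappa>) log_MU oo (fps_X * fps_deriv L) = M oo (fps_X * fps_deriv L)"
    by simp
  then have "fps_map (\<phi>KH \<circ> \<kappa>) log_MU = M"
    using L1 by (subst (asm) fps_compose_inj_right) auto
  \<comment> \<open>Homomorphisms with the same image of \<open>log_MU\<close> agree; composing with
    the inverse of \<open>\<kappa>\<close> will give part (ii).\<close>
  then have \<phi>\<kappa>: "\<phi>KH \<circ> \<kappa> = t \<circ> \<psi>"
    unfolding M_def by (intro rat_alg_hom_eq_if_log_eq rat_alg_hom_comp hom)

  have "Abs_fps (\<lambda>n. case n of 0 \<Rightarrow> 0 | Suc i \<Rightarrow> \<phi>KH (CP i)) = fps_map \<phi>KH nu_MU"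
    by (auto simp: fps_eq_iff nu_MU_nth_0 nu_MU_nth_Suc \<phi>.zero split: nat.split)
  \<comment> \<open>Since \<open>F'\<close> is the image of \<open>F\<close> under
    \<open>\<kappa>\<close>, the target of the pushed isomorphism is the law for
    \<open>\<phi>KH \<circ> \<kappa>\<close>.\<close>
  moreover have "push_fgl \<phi>KH F' = push_fgl (t \<circ> \<psi>) F"
    using assms(3) by (simp add: is_classifying_map_def push_fgl_comp flip: \<phi>\<kappa>)
  ultimately have "strict_iso (push_fgl \<phi>KH F) (push_fgl (t \<circ> \<psi>) F)
      (Abs_fps (\<lambda>n. case n of 0 \<Rightarrow> 0 | Suc i \<Rightarrow> \<phi>KH (CP i)))"
    using \<phi>.strict_iso_push[OF assms(2)] by simp
  moreover have "\<phi>KH = t \<circ> \<psi> \<circ> inv \<kappa>"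
    using bij by (simp add: comp_assoc bij_is_surj surj_iff[THEN iffD1] flip: \<phi>\<kappa>)
  ultimately show ?thesis
    using bij by blast
qed

end
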